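(* Let $G$ be a connected simple graph with $n$ vertices and $m$ edges, and let $R(G)$ be its set of $2m$ arcs (each edge $uv$ gives the two arcs $(u,v)$ and $(v,u)$). Let $p,q$ be positive integers and let $\mathbf{d}_1$ be a $p\times 2m$ and $\mathbf{d}_2$ a $q\times 2m$ complex matrix (columns indexed by $R(G)$) with $\mathbf{d}_1\mathbf{d}_1^*=\mathbf{I}_p$ and $\mathbf{d}_2\mathbf{d}_2^*=\mathbf{I}_q$. For complex numbers $a_1,b_1,a_2,b_2$ put $$\mathbf{C}_i=a_i\mathbf{d}_i^*\mathbf{d}_i+b_i(\mathbf{I}_{2m}-\mathbf{d}_i^*\mathbf{d}_i)\quad(i=1,2),\qquad \mathbf{U}=\mathbf{C}_1\mathbf{C}_2,$$ and assume $\mathbf{C}_1,\mathbf{C}_2$ are unitary with spectra $\sigma(\mathbf{C}_i)=\{a_i,b_i\}$ $(i=1,2)$, so that $p=\dim\ker(a_1-\mathbf{C}_1)$ and $q=\dim\ker(a_2-\mathbf{C}_2)$. Let $\zeta(G,u)=\det(\mathbf{I}_{2m}-u\mathbf{U})^{-1}$ and $c_i=a_i-b_i$ $(i=1,2)$. Then $$\zeta(G,u)^{-1}=\det(\mathbf{I}_{2m}-u\mathbf{U})=(1-b_1b_2u)^{2m-p-q}(1-a_2b_1u)^{q-p}\det\big((1-a_1b_2u)(1-a_2b_1u)\mathbf{I}_p-c_1c_2u\,\mathbf{d}_1\mathbf{d}_2^*\mathbf{d}_2\mathbf{d}_1^*\big).$$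
   Context: $\mathbf{d}_i^*$ denotes the conjugate transpose. The identity is an identity of rational functions in the complex variable $u$. *)

theory Defs
  imports
    "Jordan_Normal_Form.Spectral_Radius"
    "Jordan_Normal_Form.Schur_Decomposition"
    "Graph_Theory.Pair_Digraph"
    "Graph_Theory.Digraph_Component"
begin

text \<open>
  A finite simple graph is a locale instance of \<open>pair_graph\<close>: a finite loopless digraph whose set
  of arcs \<open>parcs G\<close> is a symmetric set of pairs of vertices.  Hence \<open>parcs G\<close> is
  the set of arcs \<open>R(G)\<close>, and the undirected edges are the two-element sets below.
\<close>

definition edges :: "'v pair_pre_digraph \<Rightarrow> 'v set set" where
  "edges G = {{u, v} | u v. (u, v) \<in> parcs G}"

text \<open>
  Library matrices are indexed by initial segments of the naturals.  A matrix whose columns are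
  indexed by arcs is a function \<open>f\<close> of a row number and an arc; it becomes a library matrix through
  an enumeration \<open>e\<close> of the \<open>N\<close> arcs.
\<close>

definition arc_mat :: "nat \<Rightarrow> nat \<Rightarrow> (nat \<Rightarrow> 'v \<times> 'v) \<Rightarrow> (nat \<Rightarrow> 'v \<times> 'v \<Rightarrow> complex) \<Rightarrow> complex mat"
  where "arc_mat r N e f = mat r N (\<lambda>(i, j). f i (e j))"

definition unitary_mat :: "complex mat \<Rightarrow> bool" where
  "unitary_mat A \<longleftrightarrow> square_mat A \<and>
     A * mat_adjoint A = 1\<^sub>m (dim_row A) \<and> mat_adjoint A * A = 1\<^sub>m (dim_row A)"

definition coin :: "complex \<Rightarrow> complex \<Rightarrow> complex mat \<Rightarrow> complex mat" where
  "coin a b d =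
     a \<cdot>\<^sub>m (mat_adjoint d * d) + b \<cdot>\<^sub>m (1\<^sub>m (dim_col d) - mat_adjoint d * d)"

definition walk_zeta :: "complex mat \<Rightarrow> complex \<Rightarrow> complex" where
  "walk_zeta U u = inverse (det (1\<^sub>m (dim_row U) - u \<cdot>\<^sub>m U))"

end

theory Submission
  imports Defs
begin

text \<open>
  Put \<open>P = d\<^sub>1\<^sup>* d\<^sub>1\<close>, \<open>x = 1 - b\<^sub>1 b\<^sub>2 u\<close>, \<open>y = 1 - a\<^sub>1 b\<^sub>2 u\<close>, \<open>z = 1 - a\<^sub>2 b\<^sub>1 u\<close>.  Since \<open>P\<close> is idempotent, for
  \<open>x, y \<noteq> 0\<close> the matrix \<open>X = I - b\<^sub>2 u C\<^sub>1\<close> is invertible and \<open>Y = X\<^sup>-\<^sup>1 C\<^sub>1\<close> is a combination of \<open>I\<close> and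
  \<open>P\<close>, so \<open>I - u U = X (I - c\<^sub>2 u Y d\<^sub>2\<^sup>* d\<^sub>2)\<close>.  Three uses of Sylvester's identity
  \<open>det (I - M K) = det (I - K M)\<close> evaluate \<open>det X\<close>, reduce the second factor to size \<open>q\<close>, and pass
  from size \<open>q\<close> to size \<open>p\<close>.  The parameters with \<open>x y z = 0\<close> are reached by continuity in \<open>u\<close>, once
  negative powers of \<open>x\<close> and \<open>z\<close> have been moved to the other side.
\<close>

section \<open>Sylvester's determinant identity, plain and scaled\<close>

text \<open>The block matrix \<open>?F\<close> with off-diagonal blocks \<open>M\<close>,
  \<open>K\<close> becomes block upper triangular after multiplication by the unitriangular
  \<open>?L\<close> on either side. The two products have the same determinant, and their diagonal
  blocks give the two sides.\<close>

lemma det_one_minus_mult_commute: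
  fixes M K :: "'a :: idom mat"
  assumes M: "M \<in> carrier_mat n k" and K: "K \<in> carrier_mat k n"
  shows "det (1\<^sub>m n - M * K) = det (1\<^sub>m k - K * M)"
proof -
  let ?F = "four_block_mat (1\<^sub>m n) M K (1\<^sub>m k)"
  let ?L = "four_block_mat (1\<^sub>m n) (0\<^sub>m n k) (- K) (1\<^sub>m k)"
  have F: "?F \<in> carrier_mat (n + k) (n + k)" and L: "?L \<in> carrier_mat (n + k) (n + k)"
    using M K by auto
  have detL: "det ?L = 1"
    by (subst det_four_block_mat_upper_right_zero[of _ n _ k]) (use K in auto)
  have MK: "M * - K = - (M * K)" and KM: "- K * M = - (K * M)"
    using M K by (auto simp: uminus_mult_left_mat uminus_mult_right_mat)
  have "?F * ?L = four_block_mat (1\<^sub>m n - M * K) M (0\<^sub>m k n) (1\<^sub>m k)"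
    by (subst mult_four_block_mat[of _ n n _ k _ k _ _ n _ k])
      (use M K in \<open>auto simp: MK minus_add_uminus_mat intro!: cong_four_block_mat\<close>)
  then have "det (?F * ?L) = det (1\<^sub>m n - M * K)"
    using det_four_block_mat_lower_left_zero[of "1\<^sub>m n - M * K" n M k "0\<^sub>m k n" "1\<^sub>m k"] M K
    by (simp add: minus_carrier_mat)
  moreover have "?L * ?F = four_block_mat (1\<^sub>m n) M (0\<^sub>m k n) (1\<^sub>m k - K * M)"
    by (subst mult_four_block_mat[of _ n n _ k _ k _ _ n _ k])
      (use M K in \<open>auto simp: KM minus_add_uminus_mat intro!: cong_four_block_mat\<close>)
  then have "det (?L * ?F) = det (1\<^sub>m k - K * M)"
    using det_four_block_mat_lower_left_zero[of "1\<^sub>m n" n M k "0\<^sub>m k n" "1\<^sub>m k - K * M"] M K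
    by (simp add: minus_carrier_mat)
  ultimately show ?thesis
    using det_mult[OF F L] det_mult[OF L F] detL by simp
qed

text \<open>Sylvester's identity for \<open>(s / t) \<cdot>\<^sub>m M\<close> and \<open>K\<close>;
  pulling \<open>t\<close> out of determinants of sizes \<open>n\<close> and \<open>k\<close>
  accounts for the powers.\<close>

lemma det_smult_one_minus_mult_commute:
  fixes M K :: "'a :: field mat"
  assumes M: "M \<in> carrier_mat n k" and K: "K \<in> carrier_mat k n" and "t \<noteq> 0"
  shows "t ^ k * det (t \<cdot>\<^sub>m 1\<^sub>m n - s \<cdot>\<^sub>m (M * K)) = t ^ n * det (t \<cdot>\<^sub>m 1\<^sub>m k - s \<cdot>\<^sub>m (K * M))"
proof -
  let ?M = "(s / t) \<cdot>\<^sub>m M"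
  have N: "t \<cdot>\<^sub>m 1\<^sub>m n - s \<cdot>\<^sub>m (M * K) = t \<cdot>\<^sub>m (1\<^sub>m n - ?M * K)"
    using M K \<open>t \<noteq> 0\<close> by (intro eq_matI) (auto simp: algebra_simps)
  have k: "t \<cdot>\<^sub>m 1\<^sub>m k - s \<cdot>\<^sub>m (K * M) = t \<cdot>\<^sub>m (1\<^sub>m k - K * ?M)"
    using M K \<open>t \<noteq> 0\<close> by (intro eq_matI) (auto simp: algebra_simps)
  have "det (1\<^sub>m n - ?M * K) = det (1\<^sub>m k - K * ?M)"
    by (rule det_one_minus_mult_commute) (use M K in auto)
  then show ?thesis
    unfolding N k det_smult using M K by simp
qed

section \<open>The determinant at nonexceptional parameters\<close>

lemma lin_comb_mult:
  fixes P Q :: "'a :: comm_ring_1 mat"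
  assumes P: "P \<in> carrier_mat n n" and Q: "Q \<in> carrier_mat n n"
  shows "(s \<cdot>\<^sub>m 1\<^sub>m n + t \<cdot>\<^sub>m P) * (s' \<cdot>\<^sub>m 1\<^sub>m n + t' \<cdot>\<^sub>m Q) =
    (s * s') \<cdot>\<^sub>m 1\<^sub>m n + (t * s') \<cdot>\<^sub>m P + (s * t') \<cdot>\<^sub>m Q + (t * t') \<cdot>\<^sub>m (P * Q)"
proof -
  let ?R = "s' \<cdot>\<^sub>m 1\<^sub>m n + t' \<cdot>\<^sub>m Q"
  have R: "?R \<in> carrier_mat n n" using Q by simp
  have "(s \<cdot>\<^sub>m 1\<^sub>m n + t \<cdot>\<^sub>m P) * ?R = s \<cdot>\<^sub>m ?R + t \<cdot>\<^sub>m (P * ?R)"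
    using P R by (subst add_mult_distrib_mat[of _ n n _ _ n]) (auto simp: mult_smult_assoc_mat[of _ n n])
  also have "P * ?R = s' \<cdot>\<^sub>m P + t' \<cdot>\<^sub>m (P * Q)"
    using P Q by (subst mult_add_distrib_mat[of _ n n _ n]) (auto simp: mult_smult_distrib)
  finally show ?thesis
    using P Q by (intro eq_matI) (auto simp: algebra_simps)
qed

text \<open>The first factor is \<open>1 - u b2 C\<close> with \<open>C = b1 + c1 P\<close>; it acts
  as \<open>x\<close> on the kernel of \<open>P\<close> and as \<open>y\<close> on its range. The
  combination multiplying \<open>Q\<close> acts there as \<open>b1 / x\<close> and
  \<open>(b1 + c1) / y\<close>, so it is the quotient of \<open>C\<close> by that factor.\<close>

lemma one_minus_coin_product_factor:
  fixes P Q :: "'a :: field mat"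
  assumes P: "P \<in> carrier_mat n n" and Q: "Q \<in> carrier_mat n n" and idem: "P * P = P"
    and x: "x = 1 - b1 * b2 * u" "x \<noteq> 0" and y: "y = 1 - (b1 + c1) * b2 * u" "y \<noteq> 0"
  shows "1\<^sub>m n - u \<cdot>\<^sub>m ((b1 \<cdot>\<^sub>m 1\<^sub>m n + c1 \<cdot>\<^sub>m P) * (b2 \<cdot>\<^sub>m 1\<^sub>m n + c2 \<cdot>\<^sub>m Q)) =
    (x \<cdot>\<^sub>m 1\<^sub>m n - (u * b2 * c1) \<cdot>\<^sub>m P) *
    (1\<^sub>m n - (u * c2) \<cdot>\<^sub>m (((b1 / x) \<cdot>\<^sub>m 1\<^sub>m n + (c1 / (x * y)) \<cdot>\<^sub>m P) * Q))"
proof -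
  let ?X = "x \<cdot>\<^sub>m 1\<^sub>m n - (u * b2 * c1) \<cdot>\<^sub>m P"
  let ?Y = "(b1 / x) \<cdot>\<^sub>m 1\<^sub>m n + (c1 / (x * y)) \<cdot>\<^sub>m P"
  let ?C = "b1 \<cdot>\<^sub>m 1\<^sub>m n + c1 \<cdot>\<^sub>m P"
  have X: "?X \<in> carrier_mat n n" and Y: "?Y \<in> carrier_mat n n" and C: "?C \<in> carrier_mat n n"
    using P by auto
  have X_eq: "?X = x \<cdot>\<^sub>m 1\<^sub>m n + (- (u * b2 * c1)) \<cdot>\<^sub>m P"
    using P by (intro eq_matI) auto
  \<comment> \<open>The left side is the coefficient of \<open>P\<close> in \<open>?X * ?Y\<close>
    after \<open>P * P = P\<close>.\<close>
  have coeff: "x * (c1 / (x * y)) - (u * b2 * c1) * (b1 / x) - (u * b2 * c1) * (c1 / (x * y)) = c1"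
  proof -
    have "x * (c1 / (x * y)) - (u * b2 * c1) * (b1 / x) - (u * b2 * c1) * (c1 / (x * y)) =
      c1 * (x - u * b2 * b1 * y - u * b2 * c1) / (x * y)"
      using x(2) y(2) by (simp add: divide_simps) (simp add: algebra_simps)
    also have "x - u * b2 * b1 * y - u * b2 * c1 = x * y"
      unfolding x(1) y(1) by (simp add: algebra_simps)
    finally show ?thesis using x(2) y(2) by simp
  qed
  have "?X * ?Y = (x * (b1 / x)) \<cdot>\<^sub>m 1\<^sub>m n +
     (x * (c1 / (x * y)) - (u * b2 * c1) * (b1 / x) - (u * b2 * c1) * (c1 / (x * y))) \<cdot>\<^sub>m P"
    unfolding X_eq lin_comb_mult[OF P P] idem
    using P by (intro eq_matI) (auto simp: algebra_simps)
  then have XY: "?X * ?Y = ?C"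
    unfolding coeff using x(2) by simp
  have YQ: "?Y * Q \<in> carrier_mat n n" using Y Q by auto
  have "?X * (1\<^sub>m n - (u * c2) \<cdot>\<^sub>m (?Y * Q)) = ?X - (u * c2) \<cdot>\<^sub>m (?X * (?Y * Q))"
    using X YQ by (subst mult_minus_distrib_mat[of _ n n _ n]) (auto simp: mult_smult_distrib)
  also have "?X * (?Y * Q) = ?C * Q"
    using assoc_mult_mat[OF X Y Q] XY by simp
  also have "?C * Q = b1 \<cdot>\<^sub>m Q + c1 \<cdot>\<^sub>m (P * Q)"
    using P Q by (subst add_mult_distrib_mat[of _ n n _ _ n]) (auto simp: mult_smult_assoc_mat[of _ n n])
  also have "?X - (u * c2) \<cdot>\<^sub>m (b1 \<cdot>\<^sub>m Q + c1 \<cdot>\<^sub>m (P * Q)) =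
      1\<^sub>m n - u \<cdot>\<^sub>m (?C * (b2 \<cdot>\<^sub>m 1\<^sub>m n + c2 \<cdot>\<^sub>m Q))"
    unfolding lin_comb_mult[OF P Q] x(1) using P Q
    by (intro eq_matI) (auto simp: algebra_simps)
  finally show ?thesis by (rule sym)
qed

text \<open>The pairs \<open>A\<close>, \<open>A'\<close> and \<open>B\<close>, \<open>B'\<close>
  stand for the two matrices and their adjoints. Powers of \<open>x\<close> and \<open>z\<close> are
  kept on both sides so that no difference of exponents occurs.\<close>

lemma det_one_minus_coin_product:
  fixes A A' B B' :: "'a :: field mat"
  assumes A: "A \<in> carrier_mat p n" and A': "A' \<in> carrier_mat n p"
    and B: "B \<in> carrier_mat q n" and B': "B' \<in> carrier_mat n q"
    and AA': "A * A' = 1\<^sub>m p" and BB': "B * B' = 1\<^sub>m q"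
    and x: "x = 1 - b1 * b2 * u" "x \<noteq> 0" and y: "y = 1 - (b1 + c1) * b2 * u" "y \<noteq> 0"
    and z: "z = 1 - (b2 + c2) * b1 * u" "z \<noteq> 0"
  shows "x ^ (p + q) * z ^ p *
      det (1\<^sub>m n - u \<cdot>\<^sub>m ((b1 \<cdot>\<^sub>m 1\<^sub>m n + c1 \<cdot>\<^sub>m (A' * A)) * (b2 \<cdot>\<^sub>m 1\<^sub>m n + c2 \<cdot>\<^sub>m (B' * B)))) =
    x ^ n * z ^ q * det ((y * z) \<cdot>\<^sub>m 1\<^sub>m p - (c1 * c2 * u) \<cdot>\<^sub>m (A * B' * B * A'))"
proof -
  let ?P = "A' * A"
  let ?X = "x \<cdot>\<^sub>m 1\<^sub>m n - (u * b2 * c1) \<cdot>\<^sub>m ?P"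
  let ?Y = "(b1 / x) \<cdot>\<^sub>m 1\<^sub>m n + (c1 / (x * y)) \<cdot>\<^sub>m ?P"
  let ?Z = "1\<^sub>m n - (u * c2) \<cdot>\<^sub>m (?Y * (B' * B))"
  let ?E = "det ((y * z) \<cdot>\<^sub>m 1\<^sub>m p - (c1 * c2 * u) \<cdot>\<^sub>m (A * B' * B * A'))"
  have P: "?P \<in> carrier_mat n n" and Q: "B' * B \<in> carrier_mat n n" and Y: "?Y \<in> carrier_mat n n"
    using A A' B B' by auto
  have "?P * ?P = A' * (A * A' * A)"
    using A A' assoc_mult_mat[of A' n p A n "A' * A" n] assoc_mult_mat[of A p n A' p A n] by simp
  also have "\<dots> = ?P" using A A' AA' by simp
  finally have idem: "?P * ?P = ?P" .

  \<comment> \<open>Sylvester trades \<open>A' * A\<close> for \<open>A * A' = 1\<^sub>m p\<close>,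
    which leaves a scalar matrix.\<close>
  have "x ^ p * det ?X = x ^ n * det (x \<cdot>\<^sub>m 1\<^sub>m p - (u * b2 * c1) \<cdot>\<^sub>m (A * A'))"
    using A' A x(2) by (rule det_smult_one_minus_mult_commute)
  also have "x \<cdot>\<^sub>m 1\<^sub>m p - (u * b2 * c1) \<cdot>\<^sub>m (A * A') = y \<cdot>\<^sub>m 1\<^sub>m p"
    unfolding AA' x(1) y(1) by (intro eq_matI) (auto simp: algebra_simps)
  finally have detX: "x ^ p * det ?X = x ^ n * y ^ p" by simp

  \<comment> \<open>Moving \<open>B\<close> to the front produces
    \<open>B * B' = 1\<^sub>m q\<close>, whose contribution merges with the identity into the scalar
    \<open>z / x\<close>.\<close>
  have "det ?Z = det (1\<^sub>m n - ((u * c2) \<cdot>\<^sub>m (?Y * B')) * B)"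
    using Y B B' assoc_mult_mat[OF Y B' B] mult_smult_assoc_mat[of "?Y * B'" n q B n]
    by simp
  also have "\<dots> = det (1\<^sub>m q - B * ((u * c2) \<cdot>\<^sub>m (?Y * B')))"
    by (rule det_one_minus_mult_commute) (use Y B B' in auto)
  also have "?Y * B' = (b1 / x) \<cdot>\<^sub>m B' + (c1 / (x * y)) \<cdot>\<^sub>m (?P * B')"
    using P B' by (subst add_mult_distrib_mat[of _ n n _ _ q]) (auto simp: mult_smult_assoc_mat[of _ n n])
  also have "B * ((u * c2) \<cdot>\<^sub>m \<dots>) = (u * c2) \<cdot>\<^sub>m ((b1 / x) \<cdot>\<^sub>m (B * B') + (c1 / (x * y)) \<cdot>\<^sub>m (B * (?P * B')))"
    using P B B' by (simp add: mult_add_distrib_mat[of _ q n _ q] mult_smult_distrib[of _ q n _ q])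
  also have "B * (?P * B') = (B * A') * (A * B')"
    using A A' B B' assoc_mult_mat[OF A' A B'] assoc_mult_mat[of B q n A' p "A * B'" q] by simp
  also have "1\<^sub>m q - (u * c2) \<cdot>\<^sub>m ((b1 / x) \<cdot>\<^sub>m (B * B') + (c1 / (x * y)) \<cdot>\<^sub>m ((B * A') * (A * B'))) =
    (z / x) \<cdot>\<^sub>m 1\<^sub>m q - (c1 * c2 * u / (x * y)) \<cdot>\<^sub>m ((B * A') * (A * B'))"
  proof -
    have zx: "z / x = 1 - u * c2 * (b1 / x)"
      using x(2) unfolding z(1) by (simp add: divide_simps) (simp add: x(1) algebra_simps)
    show ?thesis
      unfolding BB' zx using A A' B B' by (intro eq_matI) (auto simp: algebra_simps)
  qed
  finally have detZ: "det ?Z = det ((z / x) \<cdot>\<^sub>m 1\<^sub>m q - (c1 * c2 * u / (x * y)) \<cdot>\<^sub>m ((B * A') * (A * B')))" .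
  \<comment> \<open>The passage from size \<open>q\<close> to size \<open>p\<close>, with scale
    \<open>t = z / x\<close>; the factor \<open>(x * y) ^ p\<close> then clears the denominators
    inside the determinant.\<close>
  have "(z / x) ^ p * det ?Z =
      (z / x) ^ q * det ((z / x) \<cdot>\<^sub>m 1\<^sub>m p - (c1 * c2 * u / (x * y)) \<cdot>\<^sub>m ((A * B') * (B * A')))"
    unfolding detZ
    by (rule det_smult_one_minus_mult_commute) (use A A' B B' x z in auto)
  also have "(A * B') * (B * A') = A * B' * B * A'"
    using A A' B B' assoc_mult_mat[of "A * B'" p q B n A' p] by simp
  finally have "(x * y) ^ p * ((z / x) ^ p * det ?Z) = (z / x) ^ q *
      ((x * y) ^ p * det ((z / x) \<cdot>\<^sub>m 1\<^sub>m p - (c1 * c2 * u / (x * y)) \<cdot>\<^sub>m (A * B' * B * A')))"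
    by simp
  also have "(x * y) ^ p * det ((z / x) \<cdot>\<^sub>m 1\<^sub>m p - (c1 * c2 * u / (x * y)) \<cdot>\<^sub>m (A * B' * B * A')) =
      det ((x * y) \<cdot>\<^sub>m ((z / x) \<cdot>\<^sub>m 1\<^sub>m p - (c1 * c2 * u / (x * y)) \<cdot>\<^sub>m (A * B' * B * A')))"
    using A' by simp
  also have "(x * y) \<cdot>\<^sub>m ((z / x) \<cdot>\<^sub>m 1\<^sub>m p - (c1 * c2 * u / (x * y)) \<cdot>\<^sub>m (A * B' * B * A')) =
      (y * z) \<cdot>\<^sub>m 1\<^sub>m p - (c1 * c2 * u) \<cdot>\<^sub>m (A * B' * B * A')"
    using A A' B B' x(2) y(2) by (intro eq_matI) (auto simp: algebra_simps)
  finally have detZ': "x ^ q * (y ^ p * z ^ p * det ?Z) = z ^ q * ?E"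
    using x(2) by (simp add: power_mult_distrib power_divide field_simps)

  have "det (1\<^sub>m n - u \<cdot>\<^sub>m ((b1 \<cdot>\<^sub>m 1\<^sub>m n + c1 \<cdot>\<^sub>m ?P) * (b2 \<cdot>\<^sub>m 1\<^sub>m n + c2 \<cdot>\<^sub>m (B' * B)))) = det (?X * ?Z)"
    using one_minus_coin_product_factor[OF P Q idem x y] by simp
  also have "\<dots> = det ?X * det ?Z"
    by (rule det_mult[of _ n]) (intro minus_carrier_mat smult_carrier_mat mult_carrier_mat[OF Y Q] P)+
  finally have D: "det (1\<^sub>m n - u \<cdot>\<^sub>m ((b1 \<cdot>\<^sub>m 1\<^sub>m n + c1 \<cdot>\<^sub>m ?P) * (b2 \<cdot>\<^sub>m 1\<^sub>m n + c2 \<cdot>\<^sub>m (B' * B))))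
    = det ?X * det ?Z" .
  have "x ^ (p + q) * z ^ p * (det ?X * det ?Z) = (x ^ p * det ?X) * (x ^ q * z ^ p * det ?Z)"
    by (simp add: power_add)
  \<comment> \<open>The \<open>y ^ p\<close> from \<open>det ?X\<close> is exactly the one that
    \<open>detZ'\<close> absorbs, so no power of \<open>y\<close> survives.\<close>
  also have "\<dots> = x ^ n * (x ^ q * (y ^ p * z ^ p * det ?Z))"
    unfolding detX by simp
  also have "\<dots> = x ^ n * z ^ q * ?E"
    unfolding detZ' by simp
  finally show ?thesis unfolding D .
qed

section \<open>Continuity and integer exponents\<close>

text \<open>The Leibniz formula makes the determinant a polynomial in \<open>f u\<close> and
  \<open>g u\<close>.\<close>

lemma isCont_det_diff_smult:
  fixes A B :: "complex mat"
  assumes A: "A \<in> carrier_mat k k" and B: "B \<in> carrier_mat k k"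
    and "isCont f u" "isCont g u"
  shows "isCont (\<lambda>u. det (f u \<cdot>\<^sub>m A - g u \<cdot>\<^sub>m B)) u"
proof -
  have "det (f u \<cdot>\<^sub>m A - g u \<cdot>\<^sub>m B) = (\<Sum>\<pi> | \<pi> permutes {0..<k}.
      signof \<pi> * (\<Prod>i = 0..<k. f u * A $$ (i, \<pi> i) - g u * B $$ (i, \<pi> i)))" for u
    using A B by (subst det_def'[of _ k])
      (auto intro!: sum.cong prod.cong arg_cong2[of _ _ _ _ "(*)"] simp: permutes_in_image)
  then show ?thesis
    using assms(3,4) by (simp add: continuous_intros)
qed

text \<open>Near \<open>u\<close>, but away from \<open>u\<close> itself, the finite set
  \<open>S\<close> is avoided, so both functions have the same limit at \<open>u\<close>.\<close>

lemma eq_at_if_isCont_eq_off_finite: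
  fixes f g :: "complex \<Rightarrow> complex"
  assumes "isCont f u" "isCont g u" "finite S" and eq: "\<And>w. w \<notin> S \<Longrightarrow> f w = g w"
  shows "f u = g u"
proof (rule tendsto_unique[of "at u"])
  have "open (- (S - {u}))"
    by (intro open_Compl finite_imp_closed finite_Diff \<open>finite S\<close>)
  then have "eventually (\<lambda>w. w \<in> - (S - {u})) (at u)"
    by (rule eventually_at_in_open') simp
  moreover have "eventually (\<lambda>w. w \<noteq> u) (at u)" by (simp add: eventually_at_filter)
  ultimately have "eventually (\<lambda>w. g w = f w) (at u)"
    by eventually_elim (use eq in auto)
  then show "(f \<longlongrightarrow> g u) (at u)"
    using assms(2) by (auto simp: isCont_def intro: Lim_transform_eventually)
qed (use assms(1) in \<open>auto simp: isCont_def\<close>)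

text \<open>Truncated subtraction makes at most one of \<open>b - a\<close> and \<open>a - b\<close>
  nonzero, so one formula treats both signs of the exponent.\<close>

lemma power_int_of_nat_diff:
  fixes x :: "'a :: field"
  assumes "a < b \<Longrightarrow> x \<noteq> 0"
  shows "x powi (int a - int b) * x ^ (b - a) = x ^ (a - b)"
proof (cases "a < b")
  case True
  then have diff: "int a - int b = - int (b - a)" by simp
  show ?thesis
    unfolding diff power_int_minus power_int_of_nat using True assms by simp
next
  case False
  then have diff: "int a - int b = int (a - b)" by simp
  show ?thesis
    unfolding diff power_int_of_nat using False by simp
qed

lemma finite_zeros_one_minus_mult: "finite {w. 1 - c * w = (0 :: complex)}"
  by (rule finite_subset[of _ "{inverse c}"]) (auto simp: inverse_unique)

lemma coin_eq:
  assumes "d \<in> carrier_mat r k"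
  shows "coin a b d = b \<cdot>\<^sub>m 1\<^sub>m k + (a - b) \<cdot>\<^sub>m (mat_adjoint d * d)"
  using assms unfolding coin_def
  by (intro eq_matI) (auto simp: algebra_simps mat_adjoint_def)

text \<open>The identity of rational functions is read pointwise in \<open>u\<close>. The last two
  assumptions exclude the zeros of a base exactly when its exponent is negative. Zeros of the
  determinant are harmless for the zeta function because \<open>inverse 0 = 0\<close>.\<close>

theorem theorem5:
  fixes G :: "'v pair_pre_digraph"
    and n m p q :: nat
    and arc :: "nat \<Rightarrow> 'v \<times> 'v"
    and f1 f2 :: "nat \<Rightarrow> 'v \<times> 'v \<Rightarrow> complex"
    and d1 d2 C1 C2 U :: "complex mat"
    and a1 b1 a2 b2 c1 c2 u :: complex
  assumes "pair_graph G"
    and "Digraph_Component.connected (with_proj G)"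
    and "n = card (pverts G)"
    and "m = card (edges G)"
    and "bij_betw arc {..<2 * m} (parcs G)"
    and "p > 0" and "q > 0"
    and "d1 = arc_mat p (2 * m) arc f1"
    and "d2 = arc_mat q (2 * m) arc f2"
    and "d1 * mat_adjoint d1 = 1\<^sub>m p"
    and "d2 * mat_adjoint d2 = 1\<^sub>m q"
    and "C1 = coin a1 b1 d1"
    and "C2 = coin a2 b2 d2"
    and "U = C1 * C2"
    and "unitary_mat C1" and "unitary_mat C2"
    and "spectrum C1 = {a1, b1}" and "spectrum C2 = {a2, b2}"
    and "c1 = a1 - b1" and "c2 = a2 - b2"
    and "2 * m < p + q \<Longrightarrow> 1 - b1 * b2 * u \<noteq> 0"
    and "q < p \<Longrightarrow> 1 - a2 * b1 * u \<noteq> 0"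
  shows "inverse (walk_zeta U u) = det (1\<^sub>m (2 * m) - u \<cdot>\<^sub>m U) \<and>
    det (1\<^sub>m (2 * m) - u \<cdot>\<^sub>m U) =
      (1 - b1 * b2 * u) powi (int (2 * m) - int p - int q) *
      (1 - a2 * b1 * u) powi (int q - int p) *
      det (((1 - a1 * b2 * u) * (1 - a2 * b1 * u)) \<cdot>\<^sub>m 1\<^sub>m p -
           (c1 * c2 * u) \<cdot>\<^sub>m (d1 * mat_adjoint d2 * d2 * mat_adjoint d1))"
proof -
  define N where "N = 2 * m"
  have d1: "d1 \<in> carrier_mat p N" and d2: "d2 \<in> carrier_mat q N"
    using assms(8,9) by (auto simp: arc_mat_def N_def)
  then have ad: "mat_adjoint d1 \<in> carrier_mat N p" "mat_adjoint d2 \<in> carrier_mat N q"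
    by (auto simp: mat_adjoint_def)
  have C: "C1 = b1 \<cdot>\<^sub>m 1\<^sub>m N + c1 \<cdot>\<^sub>m (mat_adjoint d1 * d1)"
    "C2 = b2 \<cdot>\<^sub>m 1\<^sub>m N + c2 \<cdot>\<^sub>m (mat_adjoint d2 * d2)"
    using coin_eq[OF d1] coin_eq[OF d2] assms(12,13,19,20) by simp_all
  have U: "U \<in> carrier_mat N N"
    unfolding assms(14) C using d1 d2 ad by auto
  have one: "1 \<cdot>\<^sub>m 1\<^sub>m N = (1\<^sub>m N :: complex mat)"
    by (intro eq_matI) auto
  let ?W = "d1 * mat_adjoint d2 * d2 * mat_adjoint d1"
  have W: "?W \<in> carrier_mat p p"
    using d1 d2 ad by auto
  define x y z where "x = (\<lambda>w. 1 - b1 * b2 * w)" and "y = (\<lambda>w. 1 - a1 * b2 * w)"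
    and "z = (\<lambda>w. 1 - a2 * b1 * w)"
  \<comment> \<open>The factor \<open>1\<close> gives \<open>D\<close> the shape required by
    \<open>isCont_det_diff_smult\<close>, with constant \<open>f\<close>.\<close>
  define D E where "D = (\<lambda>w. det (1 \<cdot>\<^sub>m 1\<^sub>m N - w \<cdot>\<^sub>m U))"
    and "E = (\<lambda>w. det ((y w * z w) \<cdot>\<^sub>m 1\<^sub>m p - (c1 * c2 * w) \<cdot>\<^sub>m ?W))"
  have cont: "isCont x w" "isCont y w" "isCont z w" for w
    by (auto simp: x_def y_def z_def)
  have contD: "isCont D w" and contE: "isCont E w" for w
    unfolding D_def E_def using U W cont
    by (auto intro!: isCont_det_diff_smult continuous_intros)
  let ?S = "{w. x w = 0} \<union> {w. y w = 0} \<union> {w. z w = 0}"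
  \<comment> \<open>By truncated subtraction each base has a nontrivial power on at most one side.
    Both sides are continuous, and the excluded set is finite because \<open>x\<close>,
    \<open>y\<close>, \<open>z\<close> are affine with value 1 at 0.\<close>
  have main: "x u ^ (p + q - N) * z u ^ (p - q) * D u = x u ^ (N - (p + q)) * z u ^ (q - p) * E u"
  proof (rule eq_at_if_isCont_eq_off_finite[where S = ?S
        and f = "\<lambda>w. x w ^ (p + q - N) * z w ^ (p - q) * D w"
        and g = "\<lambda>w. x w ^ (N - (p + q)) * z w ^ (q - p) * E w"])
    show "finite ?S"
      unfolding x_def y_def z_def using finite_zeros_one_minus_mult by blast
  next
    fix w assume "w \<notin> ?S"
    then have nz: "x w \<noteq> 0" "y w \<noteq> 0" "z w \<noteq> 0" by auto
    have main: "x w ^ (p + q) * z w ^ p * D w = x w ^ N * z w ^ q * E w"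
      unfolding D_def E_def one assms(14) C
      using det_one_minus_coin_product[OF d1 ad(1) d2 ad(2) assms(10,11),
          of "x w" b1 b2 w "y w" c1 "z w" c2] nz assms(19,20)
      by (simp add: x_def y_def z_def)
    \<comment> \<open>Both exponents are the maximum of \<open>N\<close> and \<open>p + q\<close>;
      in \<open>pz\<close>, that of \<open>p\<close> and \<open>q\<close>.\<close>
    have px: "x w ^ N * x w ^ (p + q - N) = x w ^ (p + q) * x w ^ (N - (p + q))"
      and pz: "z w ^ q * z w ^ (p - q) = z w ^ p * z w ^ (q - p)"
      unfolding power_add[symmetric] by (intro arg_cong2[of _ _ _ _ power] refl; arith)+
    have "(x w ^ (p + q) * z w ^ p) * (x w ^ (p + q - N) * z w ^ (p - q) * D w) =
        (x w ^ (p + q) * z w ^ p * D w) * (x w ^ (p + q - N) * z w ^ (p - q))"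
      by (simp only: ac_simps)
    also have "\<dots> = (x w ^ N * x w ^ (p + q - N)) * (z w ^ q * z w ^ (p - q)) * E w"
      unfolding main by (simp only: ac_simps)
    also have "\<dots> = (x w ^ (p + q) * z w ^ p) * (x w ^ (N - (p + q)) * z w ^ (q - p) * E w)"
      unfolding px pz by (simp only: ac_simps)
    finally have "(x w ^ (p + q) * z w ^ p) * (x w ^ (p + q - N) * z w ^ (p - q) * D w) =
        (x w ^ (p + q) * z w ^ p) * (x w ^ (N - (p + q)) * z w ^ (q - p) * E w)" .
    then show "x w ^ (p + q - N) * z w ^ (p - q) * D w = x w ^ (N - (p + q)) * z w ^ (q - p) * E w"
      using nz by simp
  qed (auto intro!: continuous_intros cont contD contE)
  have nz: "N < p + q \<Longrightarrow> x u \<noteq> 0" "q < p \<Longrightarrow> z u \<noteq> 0"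
    using assms(21,22) by (auto simp: N_def x_def z_def)
  have px: "x u ^ (N - (p + q)) = x u powi (int N - int (p + q)) * x u ^ (p + q - N)"
    and pz: "z u ^ (q - p) = z u powi (int q - int p) * z u ^ (p - q)"
    by (rule power_int_of_nat_diff[symmetric], erule nz)+
  have "(x u ^ (p + q - N) * z u ^ (p - q)) * D u = (x u ^ (p + q - N) * z u ^ (p - q)) *
      (x u powi (int N - int (p + q)) * z u powi (int q - int p) * E u)"
    unfolding main px pz by (simp only: ac_simps)
  \<comment> \<open>Either the exponent is 0 and the power is 1, or \<open>nz\<close>
    applies.\<close>
  moreover have "x u ^ (p + q - N) \<noteq> 0" "z u ^ (p - q) \<noteq> 0"
    using nz by auto
  ultimately have "D u = x u powi (int N - int (p + q)) * z u powi (int q - int p) * E u"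
    by auto
  moreover have "D u = det (1\<^sub>m (2 * m) - u \<cdot>\<^sub>m U)"
    by (simp only: D_def one) (simp only: N_def)
  ultimately show ?thesis
    using U by (simp add: walk_zeta_def N_def x_def y_def z_def E_def diff_diff_eq)
qed

end
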